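(* Consider the Scarf-Hirota model with endowment matrix $A$ satisfying $A\mathbf{u}=\mathbf{u}$, $\mathbf{u}^TA=\mathbf{u}^T$ (with $\mathbf{u}=(1,1,1)^T$), with parameters $d_1,d_2,d_3,K,L$ and excess demand functions $E_i$ as defined in the context. Suppose $d_1>0$, $d_2>0$, $d_3>0$, and let $$\hat H=4(d_1d_2+d_2d_3+d_3d_1)-(d_1+d_2+d_3)^2+(K-L)^2.$$ Consider the system of differential equations $$\frac{dp_i}{dt}=p_iE_i(\mathbf{p}),\qquad i=1,2,3,$$ on the triangle $\triangle=\{\mathbf{p} : p_1+p_2+p_3=1,\ p_1\ge0,\ p_2\ge0,\ p_3\ge0\}$ with its vertices removed. Then: (1) if $\hat H<0$, the system has locally asymptotically stable fixed points on the edges (that is, the set of such points is nonempty); (2) if $\hat H>0$, the system has no locally asymptotically stable points on the edges. Here the edges are the three open edges $\{\mathbf{p}\in\triangle : p_i=0,\ p_j>0 \text{ for } j\ne i\}$, $i=1,2,3$, and local asymptotic stability is with respect to the flow on $\triangle$ with its vertices removed.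
   Context: Scarf-Hirota model: $\mathbf{a}_h=(a_{1h},a_{2h},a_{3h})^T$ is the initial endowment vector of consumer $h$ ($h=1,2,3$), and $A=[\mathbf{a}_1,\mathbf{a}_2,\mathbf{a}_3]=(a_{ih})$ is the real $3\times 3$ matrix with columns $\mathbf{a}_h$. It is assumed that $A\mathbf{u}=\mathbf{u}$ and $\mathbf{u}^TA=\mathbf{u}^T$ with $\mathbf{u}=(1,1,1)^T$. Such a matrix is written $$A=\begin{bmatrix} d_1 & d_3+L & d_2+K\\ d_3+K & d_2 & d_1+L\\ d_2+L & d_1+K & d_3\end{bmatrix},$$ with real parameters $d_1,d_2,d_3,K,L$ satisfying $d_1+d_2+d_3+K+L=1$. Let $\mathbf{b}_1=(0,1,1)^T$, $\mathbf{b}_2=(1,0,1)^T$, $\mathbf{b}_3=(1,1,0)^T$, $B=[\mathbf{b}_1,\mathbf{b}_2,\mathbf{b}_3]$. For $\mathbf{p}=(p_1,p_2,p_3)^T$ put $f_h=\dfrac{\mathbf{p}^T\mathbf{a}_h}{\mathbf{p}^T\mathbf{b}_h}$, $\mathbf{f}=(f_1,f_2,f_3)^T$. The excess demand vector is $\mathbf{E}(\mathbf{p})=(E_1,E_2,E_3)^T=B\mathbf{f}-A\mathbf{u}$; thus $E_1=f_2+f_3-1$, $E_2=f_3+f_1-1$, $E_3=f_1+f_2-1$. The quantity $p_1+p_2+p_3$ is constant along solutions of the system, and each edge is invariant. The vector field is not defined at the vertices of $\triangle$. *)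

theory Defs
  imports "HOL-Analysis.Analysis"
begin

definition uvec :: "real^3" where
  "uvec = vector [1, 1, 1]"

definition endowment_matrix :: "real \<Rightarrow> real \<Rightarrow> real \<Rightarrow> real \<Rightarrow> real \<Rightarrow> real^3^3" where
  "endowment_matrix d1 d2 d3 K L =
     vector [vector [d1,     d3 + L, d2 + K],
             vector [d3 + K, d2,     d1 + L],
             vector [d2 + L, d1 + K, d3]]"

text \<open>The parametrization covers all matrices with unit row and column sums.\<close>

lemma endowment_matrix_exhaustive:
  fixes A :: "real^3^3"
  assumes "A *v uvec = uvec" and "uvec v* A = uvec"
  shows "\<exists>!(d1, d2, d3, K, L). d1 + d2 + d3 + K + L = 1 \<and> A = endowment_matrix d1 d2 d3 K L"
proof -
  have rows: "A$1$1 + A$1$2 + A$1$3 = 1" "A$2$1 + A$2$2 + A$2$3 = 1" "A$3$1 + A$3$2 + A$3$3 = 1"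
    and cols: "A$1$1 + A$2$1 + A$3$1 = 1" "A$1$2 + A$2$2 + A$3$2 = 1" "A$1$3 + A$2$3 + A$3$3 = 1"
    using assms
    by (simp_all add: vec_eq_iff forall_3 matrix_vector_mult_def vector_matrix_mult_def
        sum_3 uvec_def)
  show ?thesis
  proof (rule ex1I[of _ "(A$1$1, A$2$2, A$3$3, A$2$1 - A$3$3, A$1$2 - A$3$3)"])
    show "case (A$1$1, A$2$2, A$3$3, A$2$1 - A$3$3, A$1$2 - A$3$3) of (d1, d2, d3, K, L) \<Rightarrow>
            d1 + d2 + d3 + K + L = 1 \<and> A = endowment_matrix d1 d2 d3 K L"
      using rows cols by (simp add: vec_eq_iff forall_3 endowment_matrix_def)
  qed (auto simp: endowment_matrix_def)
qed

definition Bmat :: "real^3^3" where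
  "Bmat = vector [vector [0, 1, 1],
                  vector [1, 0, 1],
                  vector [1, 1, 0]]"

definition demand_ratio :: "real^3^3 \<Rightarrow> real^3 \<Rightarrow> real^3" where
  "demand_ratio A p = (\<chi> h. (p \<bullet> column h A) / (p \<bullet> column h Bmat))"

definition excess_demand :: "real^3^3 \<Rightarrow> real^3 \<Rightarrow> real^3" where
  "excess_demand A p = Bmat *v demand_ratio A p - A *v uvec"

definition price_field :: "real^3^3 \<Rightarrow> real^3 \<Rightarrow> real^3" where
  "price_field A p = (\<chi> i. p $ i * excess_demand A p $ i)"

definition price_triangle :: "(real^3) set" where
  "price_triangle = {p. p$1 + p$2 + p$3 = 1 \<and> p$1 \<ge> 0 \<and> p$2 \<ge> 0 \<and> p$3 \<ge> 0}"

definition punctured_triangle :: "(real^3) set" where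
  "punctured_triangle = price_triangle - range (\<lambda>i. axis i 1)"

definition open_edge :: "3 \<Rightarrow> (real^3) set" where
  "open_edge i = {p \<in> price_triangle. p $ i = 0 \<and> (\<forall>j. j \<noteq> i \<longrightarrow> p $ j > 0)}"

definition forward_solution ::
    "('a::real_normed_vector \<Rightarrow> 'a) \<Rightarrow> 'a set \<Rightarrow> 'a \<Rightarrow> (real \<Rightarrow> 'a) \<Rightarrow> bool" where
  "forward_solution F X y x \<longleftrightarrow>
     x 0 = y \<and>
     (\<forall>t\<ge>0. x t \<in> X \<and> (x has_vector_derivative F (x t)) (at t within {0..}))"

text \<open>
  Stability is relative to the state space \<open>X\<close>: only initial points in \<open>X\<close> are
  considered.  The existence clause makes the forward flow near \<open>q\<close> part of the notion,
  so that the conditions on all solutions cannot hold vacuously.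
\<close>

definition locally_asymptotically_stable ::
    "('a::real_normed_vector \<Rightarrow> 'a) \<Rightarrow> 'a set \<Rightarrow> 'a \<Rightarrow> bool" where
  "locally_asymptotically_stable F X q \<longleftrightarrow>
     q \<in> X \<and> F q = 0 \<and>
     (\<exists>\<delta>>0. \<forall>y\<in>X. dist y q < \<delta> \<longrightarrow> (\<exists>x. forward_solution F X y x)) \<and>
     (\<forall>\<epsilon>>0. \<exists>\<delta>>0. \<forall>y\<in>X. dist y q < \<delta> \<longrightarrow>
        (\<forall>x. forward_solution F X y x \<longrightarrow> (\<forall>t\<ge>0. dist (x t) q < \<epsilon>))) \<and>
     (\<exists>\<delta>>0. \<forall>y\<in>X. dist y q < \<delta> \<longrightarrow>
        (\<forall>x. forward_solution F X y x \<longrightarrow> (x \<longlongrightarrow> q) at_top))"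

definition stable_edge_points :: "real^3^3 \<Rightarrow> (real^3) set" where
  "stable_edge_points A =
     {q \<in> (\<Union>i. open_edge i).
        locally_asymptotically_stable (price_field A) punctured_triangle q}"

end

theory Submission
  imports Defs
begin

text \<open>
  Each open edge \<open>p$i = 0\<close> carries exactly one fixed point \<open>q\<close>: in the coordinate \<open>s = p$j\<close> the field on the
  edge is a quadratic polynomial, positive at \<open>s = 0\<close> and negative at \<open>s = 1\<close>, and \<open>q\<close> attracts
  within the edge (\<open>edge_velocity_factor\<close>).  Its stability in the triangle is therefore decided by the
  rate \<open>E\<^sub>i(q)\<close> at which \<open>p$i\<close> grows or shrinks near \<open>q\<close>.  The fixed point equation gives
  \<open>E\<^sub>i(q) = d\<^sub>i - d\<^sub>j - d\<^sub>k + \<sigma>\<close> with \<open>\<sigma> > 0\<close> and \<open>\<sigma>\<^sup>2 = (K - L)\<^sup>2 + 4 d\<^sub>j d\<^sub>k\<close> (\<open>transversal_rate\<close>), and for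
  every edge \<open>H = \<sigma>\<^sup>2 - (d\<^sub>j + d\<^sub>k - d\<^sub>i)\<^sup>2\<close>.

  If \<open>H > 0\<close>, then \<open>\<sigma>\<close> exceeds \<open>\<bar>d\<^sub>j + d\<^sub>k - d\<^sub>i\<bar>\<close>, all three rates are positive, and solutions that start in
  the interior next to the edge are driven away (\<open>repelling_edge_point_not_stable\<close>).  If \<open>H < 0\<close>,
  the rate has the sign of \<open>d\<^sub>i - d\<^sub>j - d\<^sub>k\<close>.  Two of the parameters cannot both be at least the
  sum of the other two, so on some edge the rate is negative and the fixed point is a
  sink (\<open>attracting_edge_fixed_point_stable\<close>).

  The analytic part is the sink.  Asymptotic stability includes that solutions exist for all
  forward times near \<open>q\<close>, so a global existence theorem is proved by Picard iteration in a weighted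
  sup norm (\<open>bounded_lipschitz_field_global_solution\<close>) and combined with a quadratic
  Lyapunov function (\<open>lyapunov_asymptotic_stability\<close>).
\<close>

section \<open>Global solutions of Lipschitz differential equations\<close>

lemma integral_has_vector_derivative_halfline:
  fixes h :: "real \<Rightarrow> 'a::banach"
  assumes "continuous_on {0..} h" and "0 \<le> t"
  shows "((\<lambda>u. integral {0..u} h) has_vector_derivative h t) (at t within {0..})"
proof -
  have "((\<lambda>u. integral {0..u} h) has_vector_derivative h t) (at t within {0..t+1})"
    by (rule integral_has_vector_derivative) (use assms in \<open>auto intro: continuous_on_subset\<close>)
  moreover have "at t within {0..t+1} = at t within {0..}"
    by (rule at_within_nhd[of t "{..<t+1}"]) auto
  ultimately show ?thesis by simp
qed

text \<open>
  Picard iteration for all forward times at once.  Writing the solution as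
  \<open>x t = y + exp (l * t) *\<^sub>R w t\<close> turns the integral equation into a fixed point equation for a
  bounded continuous \<open>w\<close>.  In the sup norm of \<open>w\<close> the exponential weight makes the integral
  operator a contraction with constant \<open>C / l\<close>, whatever the length of the time interval, so
  that no local solutions have to be glued together.  Boundedness of the field keeps the
  image of the operator bounded.
\<close>

lemma bounded_lipschitz_field_global_solution:
  fixes F :: "'a::banach \<Rightarrow> 'a"
  assumes lip: "C-lipschitz_on UNIV F" and bnd: "\<And>p. norm (F p) \<le> B"
  obtains x where "x 0 = y"
    and "\<And>t. 0 \<le> t \<Longrightarrow> (x has_vector_derivative F (x t)) (at t within {0..})"
proof -
  \<comment> \<open>any \<open>l \<ge> 2 * C\<close> gives contraction constant \<open>1/2\<close>; adding 1 keeps \<open>l\<close> positive if \<open>C = 0\<close>\<close>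
  define l where "l = 2 * C + 1"
  have C0: "0 \<le> C" using lip by (rule lipschitz_on_nonneg)
  then have l0: "0 < l" and Cl: "C / l \<le> 1/2" by (auto simp: l_def field_simps)
  have B0: "0 \<le> B" using bnd[of 0] norm_ge_zero order_trans by blast
  define h where "h w s = F (y + exp (l * s) *\<^sub>R apply_bcontfun w s)" for w s
  define P where "P w t = integral {0..t} (h w)" for w and t :: real
  have conth: "continuous_on S (h w)" for w S
  proof -
    have "continuous_on UNIV F" using lip by (rule lipschitz_on_continuous_on)
    then show ?thesis unfolding h_def
      by (rule continuous_on_compose2) (auto intro!: continuous_intros)
  qed
  have intg: "h w integrable_on {0..t}" for w t
    by (rule integrable_continuous_real) (rule conth)
  have derP: "((P w) has_vector_derivative h w t) (at t within {0..})" if "0 \<le> t" for w t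
    unfolding P_def by (rule integral_has_vector_derivative_halfline[OF conth that])
  have contP: "continuous_on {0..} (P w)" for w
    using derP by (intro continuous_on_vector_derivative) auto
  \<comment> \<open>bounded continuous functions live on all of \<open>\<real>\<close>, so the operator is extended by its
    value at 0 to negative times\<close>
  define T where "T w = Bcontfun (\<lambda>t. exp (- l * max 0 t) *\<^sub>R P w (max 0 t))" for w
  have T: "apply_bcontfun (T w) t = exp (- l * max 0 t) *\<^sub>R P w (max 0 t)" for w t
  proof -
    have "(\<lambda>t. exp (- l * max 0 t) *\<^sub>R P w (max 0 t)) \<in> bcontfun"
    proof (rule bcontfun_normI)
      have "continuous_on UNIV (\<lambda>t::real. P w (max 0 t))"
        by (rule continuous_on_compose2[OF contP]) (auto intro!: continuous_intros)
      then show "continuous_on UNIV (\<lambda>t. exp (- l * max 0 t) *\<^sub>R P w (max 0 t))"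
        by (intro continuous_intros)
      fix t :: real
      define \<tau> where "\<tau> = max 0 t"
      have \<tau>0: "0 \<le> \<tau>" by (simp add: \<tau>_def)
      have "norm (P w \<tau>) \<le> B * \<tau>"
        unfolding P_def
        using integral_bound[of 0 \<tau> "h w" B] \<tau>0 conth bnd by (auto simp: h_def)
      moreover have "l * \<tau> \<le> exp (l * \<tau>)"
        using exp_ge_add_one_self[of "l * \<tau>"] by linarith
      then have "exp (- l * \<tau>) * \<tau> \<le> 1 / l"
        using l0 by (simp add: exp_minus field_simps)
      ultimately have "exp (- l * \<tau>) * norm (P w \<tau>) \<le> B * (1 / l)"
        by (smt (verit, best) B0 exp_gt_zero mult.assoc mult.commute mult_left_mono)
      then show "norm (exp (- l * max 0 t) *\<^sub>R P w (max 0 t)) \<le> B * (1 / l)"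
        by (simp add: \<tau>_def)
    qed
    then show ?thesis by (simp add: T_def Bcontfun_inverse)
  qed
  have contr: "dist (T w) (T v) \<le> 1/2 * dist w v" for w v
  proof (rule dist_bound)
    fix t :: real
    define \<tau> where "\<tau> = max 0 t"
    have \<tau>0: "0 \<le> \<tau>" by (simp add: \<tau>_def)
    define D where "D = dist w v"
    have D0: "0 \<le> D" by (simp add: D_def)
    have I: "((\<lambda>s. C * D * exp (l * s)) has_integral
        (C * D * exp (l * \<tau>) / l - C * D * exp (l * 0) / l)) {0..\<tau>}"
      by (rule fundamental_theorem_of_calculus[OF \<tau>0])
        (use l0 in \<open>auto intro!: derivative_eq_intros
          simp: has_real_derivative_iff_has_vector_derivative[symmetric]\<close>)
    have "P w \<tau> - P v \<tau> = integral {0..\<tau>} (\<lambda>s. h w s - h v s)"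
      unfolding P_def by (rule integral_diff[symmetric]) (rule intg)+
    also have "norm \<dots> \<le> integral {0..\<tau>} (\<lambda>s. C * D * exp (l * s))"
    proof (rule integral_norm_bound_integral)
      show "(\<lambda>s. h w s - h v s) integrable_on {0..\<tau>}"
        by (intro integrable_diff intg)
      show "(\<lambda>s. C * D * exp (l * s)) integrable_on {0..\<tau>}" using I by blast
      fix s
      have "norm (h w s - h v s) \<le> C * norm (exp (l * s) *\<^sub>R (apply_bcontfun w s - apply_bcontfun v s))"
        using lipschitz_onD[OF lip, of "y + exp (l * s) *\<^sub>R apply_bcontfun w s"
            "y + exp (l * s) *\<^sub>R apply_bcontfun v s"]
        by (simp add: h_def dist_norm algebra_simps)
      also have "\<dots> \<le> C * (exp (l * s) * D)"
        using C0 dist_bounded[of w s v]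
        by (intro mult_left_mono) (auto simp: D_def dist_norm)
      finally show "norm (h w s - h v s) \<le> C * D * exp (l * s)" by (simp add: mult_ac)
    qed
    also have "\<dots> = C * D * exp (l * \<tau>) / l - C * D / l"
      using integral_unique[OF I] by simp
    also have "\<dots> \<le> C * D * exp (l * \<tau>) / l" using C0 D0 l0 by simp
    finally have "exp (- l * \<tau>) * norm (P w \<tau> - P v \<tau>)
        \<le> exp (- l * \<tau>) * (C * D * exp (l * \<tau>) / l)"
      by (intro mult_left_mono) auto
    also have "\<dots> = C / l * D" by (simp add: exp_minus field_simps)
    also have "\<dots> \<le> 1/2 * D" using Cl D0 by (rule mult_right_mono)
    finally show "dist (apply_bcontfun (T w) t) (apply_bcontfun (T v) t) \<le> 1/2 * dist w v"
      unfolding T \<tau>_def[symmetric] D_def[symmetric]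
      by (simp add: dist_norm flip: scaleR_diff_right)
  qed
  obtain w where w: "T w = w"
    using banach_fix_type[of "1/2" T] contr by auto
  have wP: "exp (l * t) *\<^sub>R apply_bcontfun w t = P w t" if "0 \<le> t" for t
    using T[of w t] that unfolding w by (simp flip: exp_add)
  show thesis
  proof (rule that[of "\<lambda>t. y + P w t"])
    show "y + P w 0 = y" by (simp add: P_def)
    fix t :: real assume "0 \<le> t"
    then show "((\<lambda>t. y + P w t) has_vector_derivative F (y + P w t)) (at t within {0..})"
      using derP[of t w] wP[of t]
      by (auto intro!: derivative_eq_intros simp: h_def)
  qed
qed

section \<open>Lyapunov functions and differential inequalities\<close>

lemma halfline_derivative_imp_continuous:
  assumes "\<And>t::real. 0 \<le> t \<Longrightarrow> (u has_vector_derivative u' t) (at t within {0..})"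
  shows "continuous_on {0..} u"
  using assms by (intro continuous_on_vector_derivative) auto

lemma halfline_derivative_nonpos_imp_le:
  fixes u :: "real \<Rightarrow> real"
  assumes der: "\<And>t. 0 \<le> t \<Longrightarrow> (u has_real_derivative u' t) (at t within {0..})"
    and "\<And>t. 0 < t \<Longrightarrow> t < b \<Longrightarrow> u' t \<le> 0" and "0 \<le> b"
  shows "u b \<le> u 0"
proof (rule DERIV_nonpos_imp_decreasing_open[OF \<open>0 \<le> b\<close>])
  have "continuous_on {0..} u"
    using der by (intro halfline_derivative_imp_continuous)
      (auto simp: has_real_derivative_iff_has_vector_derivative)
  then show "continuous_on {0..b} u" by (rule continuous_on_subset) auto
  fix t :: real assume t: "0 < t" "t < b"
  have "at t within {0..} = at t" using t by (intro at_within_interior) auto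
  then show "\<exists>y. DERIV u t :> y \<and> y \<le> 0" using der[of t] assms(2)[of t] t by auto
qed

text \<open>
  The decay estimate is only available below the level \<open>\<eta>\<close>.  It suffices: up to the first time
  at which the level is reached \<open>u\<close> is nonincreasing, so it cannot have climbed from \<open>u 0 < \<eta>\<close>
  to \<open>\<eta>\<close>.  Hence the estimate holds for ever and integrates to exponential decay.
\<close>

lemma sublevel_trapping:
  fixes u :: "real \<Rightarrow> real"
  assumes der: "\<And>t. 0 \<le> t \<Longrightarrow> (u has_real_derivative u' t) (at t within {0..})"
    and decay: "\<And>t. 0 \<le> t \<Longrightarrow> u t < \<eta> \<Longrightarrow> u' t \<le> - \<gamma> * u t"
    and nonneg: "\<And>t. 0 \<le> t \<Longrightarrow> 0 \<le> u t" and "0 \<le> \<gamma>" and "u 0 < \<eta>" and "0 \<le> t"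
  shows "u t < \<eta>" and "u t \<le> u 0 * exp (- \<gamma> * t)"
proof -
  have cont: "continuous_on {0..} u"
    using der by (intro halfline_derivative_imp_continuous)
      (auto simp: has_real_derivative_iff_has_vector_derivative)
  have below: "u s < \<eta>" if "0 \<le> s" for s
  proof (rule ccontr)
    assume "\<not> u s < \<eta>"
    define E where "E = {r \<in> {0..s}. \<eta> \<le> u r}"
    have "closed E" unfolding E_def
      by (intro continuous_on_closed_Collect_le continuous_on_subset[OF cont] continuous_intros) auto
    moreover have "bounded E"
      by (rule bounded_subset[of "{0..s}"]) (auto simp: E_def)
    ultimately have cpt: "compact E" by (simp add: compact_eq_bounded_closed)
    have "s \<in> E" using \<open>\<not> u s < \<eta>\<close> that by (auto simp: E_def)
    then obtain r where r: "r \<in> E" "\<And>r'. r' \<in> E \<Longrightarrow> r \<le> r'"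
      using compact_attains_inf[OF cpt] by auto
    have "u r \<le> u 0"
    proof (rule halfline_derivative_nonpos_imp_le[OF der])
      fix a assume a: "0 < a" "a < r"
      then have "u a < \<eta>" using r(1) r(2)[of a] by (auto simp: E_def not_le[symmetric])
      then have "u' a \<le> - \<gamma> * u a" using decay a by auto
      also have "\<dots> \<le> 0" using nonneg[of a] a \<open>0 \<le> \<gamma>\<close> by simp
      finally show "u' a \<le> 0" .
    qed (use r in \<open>auto simp: E_def\<close>)
    then show False using r \<open>u 0 < \<eta>\<close> by (auto simp: E_def)
  qed
  then show "u t < \<eta>" using \<open>0 \<le> t\<close> by blast
  have "u t * exp (\<gamma> * t) \<le> u 0 * exp (\<gamma> * 0)"
  proof (rule halfline_derivative_nonpos_imp_le[OF _ _ \<open>0 \<le> t\<close>, where u' = "\<lambda>s. (u' s + \<gamma> * u s) * exp (\<gamma> * s)"])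
    fix s :: real assume "0 \<le> s"
    then show "((\<lambda>s. u s * exp (\<gamma> * s)) has_real_derivative (u' s + \<gamma> * u s) * exp (\<gamma> * s)) (at s within {0..})"
      by (auto intro!: derivative_eq_intros der simp: algebra_simps)
  next
    fix s :: real assume "0 < s"
    then show "(u' s + \<gamma> * u s) * exp (\<gamma> * s) \<le> 0"
      using decay[of s] below[of s] by (intro mult_nonpos_nonneg) auto
  qed
  then show "u t \<le> u 0 * exp (- \<gamma> * t)" by (simp add: exp_minus field_simps)
qed

text \<open>
  With the integrating factor \<open>exp (- integral {0..t} e)\<close> the function becomes constant.  This
  is how a solution of a field of the form \<open>p\<^sub>i * E\<^sub>i(p)\<close> is seen not to leave the triangle.
\<close>

lemma linear_ode_keeps_nonneg:
  fixes u :: "real \<Rightarrow> real"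
  assumes der: "\<And>t. 0 \<le> t \<Longrightarrow> (u has_real_derivative u t * e t) (at t within {0..})"
    and "continuous_on {0..} e" and "0 \<le> u 0" and "0 \<le> t"
  shows "0 \<le> u t"
proof -
  let ?I = "\<lambda>s. integral {0..s} e"
  have dI: "(?I has_real_derivative e s) (at s within {0..})" if "0 \<le> s" for s
    using integral_has_vector_derivative_halfline[OF assms(2) that]
    by (simp add: has_real_derivative_iff_has_vector_derivative)
  have "- (u t * exp (- ?I t)) \<le> - (u 0 * exp (- ?I 0))"
  proof (rule halfline_derivative_nonpos_imp_le[OF _ _ \<open>0 \<le> t\<close>, where u' = "\<lambda>s. 0"])
    fix s :: real assume "0 \<le> s"
    then show "((\<lambda>s. - (u s * exp (- ?I s))) has_real_derivative 0) (at s within {0..})"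
      by (auto intro!: derivative_eq_intros der dI simp: algebra_simps)
  qed auto
  then have "0 \<le> u t * exp (- ?I t)" using \<open>0 \<le> u 0\<close> by simp
  then show ?thesis by (simp add: zero_le_mult_iff not_le)
qed

text \<open>
  Lyapunov's direct method relative to a state space \<open>X\<close> that lies in the hyperplane
  \<open>g p = g q\<close>.  On this hyperplane \<open>V\<close> is comparable to the squared distance from \<open>q\<close>, so its
  exponential decay gives stability and attraction.

  Existence of solutions for all times is part of the conclusion.  The field is precomposed
  with the nearest point projection onto the ball \<open>cball q \<rho>\<close>, which makes it bounded and
  globally Lipschitz without changing it on the ball; the solutions of the modified equation
  stay in the hyperplane, are trapped in the ball by \<open>V\<close>, and therefore solve the original
  equation.  That they stay in \<open>X\<close> cannot follow from \<open>V\<close>, which does not see the boundary of \<open>X\<close>,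
  and is left to the hypothesis \<open>invariant\<close>; it only has to be checked for solutions that are
  already trapped.
\<close>

lemma lyapunov_asymptotic_stability:
  fixes F :: "'a::euclidean_space \<Rightarrow> 'a" and g :: "'a \<Rightarrow> real" and V :: "'a \<Rightarrow> real"
  assumes q: "q \<in> X" "F q = 0"
    and lip: "C-lipschitz_on (cball q \<rho>) F" and \<rho>: "0 < \<rho>"
    and g: "bounded_linear g" and gX: "\<And>p. p \<in> X \<Longrightarrow> g p = g q"
    and gF: "\<And>p. p \<in> cball q \<rho> \<Longrightarrow> g (F p) = 0"
    and V: "\<And>p. (V has_derivative DV p) (at p)"
    and V_lower: "\<And>p. g p = g q \<Longrightarrow> m * (dist p q)\<^sup>2 \<le> V p" and m: "0 < m"
    and V_upper: "\<And>p. g p = g q \<Longrightarrow> V p \<le> M * (dist p q)\<^sup>2"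
    and decay: "\<And>p. p \<in> cball q \<rho> \<Longrightarrow> g p = g q \<Longrightarrow> DV p (F p) \<le> - \<gamma> * V p" and \<gamma>: "0 < \<gamma>"
    and invariant: "\<And>x t. \<lbrakk>x 0 \<in> X; \<And>s. 0 \<le> s \<Longrightarrow> x s \<in> cball q \<rho> \<and> g (x s) = g q;
         \<And>s. 0 \<le> s \<Longrightarrow> (x has_vector_derivative F (x s)) (at s within {0..}); 0 \<le> t\<rbrakk> \<Longrightarrow> x t \<in> X"
  shows "locally_asymptotically_stable F X q"
proof -
  define \<eta> where "\<eta> = m * \<rho>\<^sup>2"
  have \<eta>0: "0 < \<eta>" using m \<rho> by (simp add: \<eta>_def)
  have near: "dist p q < r" if "g p = g q" "V p < m * r\<^sup>2" "0 < r" for p r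
  proof -
    have "m * (dist p q)\<^sup>2 < m * r\<^sup>2" using V_lower that by force
    then have "(dist p q)\<^sup>2 < r\<^sup>2" using m by simp
    then show ?thesis using that(3) by (meson less_imp_le power2_less_imp_less)
  qed
  have V0: "0 \<le> V p" if "g p = g q" for p
    by (rule order_trans[OF _ V_lower[OF that]]) (use m in simp)
  have start: "\<exists>\<delta>>0. \<forall>y. dist y q < \<delta> \<longrightarrow> g y = g q \<longrightarrow> V y < v" if "0 < v" for v
  proof -
    \<comment> \<open>\<open>M\<close> may be nonpositive when the hyperplane is the point \<open>q\<close>\<close>
    define M' where "M' = max M 1"
    have M': "0 < M'" "M \<le> M'" by (auto simp: M'_def)
    show ?thesis
    proof (intro exI[of _ "sqrt (v / M')"] conjI allI impI)
      show "0 < sqrt (v / M')" using that M' by simp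
      fix y assume y: "dist y q < sqrt (v / M')" "g y = g q"
      have "(dist y q)\<^sup>2 < (sqrt (v / M'))\<^sup>2" using y(1) by (intro power_strict_mono) auto
      also have "\<dots> = v / M'" using that M' by simp
      finally have "M' * (dist y q)\<^sup>2 < v" using M' by (simp add: field_simps)
      moreover have "V y \<le> M' * (dist y q)\<^sup>2"
        by (rule order_trans[OF V_upper[OF y(2)]]) (use M' in \<open>simp add: mult_right_mono\<close>)
      ultimately show "V y < v" by simp
    qed
  qed
  \<comment> \<open>stated for a second field \<open>G\<close> because it serves both the solutions of \<open>F\<close> in \<open>X\<close> and those
    of the modified field, which are not known to be in \<open>X\<close>\<close>
  have trapped: "V (x t) \<le> V (x 0) * exp (- \<gamma> * t)" "dist (x t) q < \<rho>"
    if G: "\<And>p. p \<in> cball q \<rho> \<Longrightarrow> G p = F p"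
      and x: "\<And>t. 0 \<le> t \<Longrightarrow> (x has_vector_derivative G (x t)) (at t within {0..})"
      and gx: "\<And>t. 0 \<le> t \<Longrightarrow> g (x t) = g q" and x0: "V (x 0) < \<eta>" and "0 \<le> t" for G x t
  proof -
    have der: "((\<lambda>t. V (x t)) has_real_derivative DV (x t) (G (x t))) (at t within {0..})"
      if "0 \<le> t" for t
      using vector_derivative_diff_chain_within[OF x[OF that] has_derivative_at_withinI[OF V]]
      by (simp add: has_real_derivative_iff_has_vector_derivative o_def)
    have dec: "DV (x t) (G (x t)) \<le> - \<gamma> * V (x t)" if "0 \<le> t" "V (x t) < \<eta>" for t
      using near[OF gx[OF that(1)] that(2)[unfolded \<eta>_def] \<rho>] decay[of "x t"] gx[OF that(1)] G
      by (simp add: dist_commute less_imp_le)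
    note trap = sublevel_trapping[OF der dec V0[OF gx] less_imp_le[OF \<gamma>] x0 \<open>0 \<le> t\<close>]
    show "V (x t) \<le> V (x 0) * exp (- \<gamma> * t)" by (rule trap(2))
    show "dist (x t) q < \<rho>"
      using near[OF gx[OF \<open>0 \<le> t\<close>] _ \<rho>] trap(1) by (simp add: \<eta>_def)
  qed
  have sol: "V (x t) \<le> V (x 0) * exp (- \<gamma> * t)"
    if "forward_solution F X y x" "V y < \<eta>" "0 \<le> t" for x y t
    using that gX by (intro trapped(1)[where G = F]) (auto simp: forward_solution_def)
  obtain \<delta> where \<delta>: "0 < \<delta>" "\<And>y. y \<in> X \<Longrightarrow> dist y q < \<delta> \<Longrightarrow> V y < \<eta>"
    using start[OF \<eta>0] gX by blast
  have existence: "\<exists>x. forward_solution F X y x" if y: "y \<in> X" "dist y q < \<delta>" for y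
  proof -
    define c where "c = closest_point (cball q \<rho>)"
    define G where "G p = F (c p)" for p
    have c: "c p \<in> cball q \<rho>" for p
      unfolding c_def using \<rho> by (intro closest_point_in_set) auto
    have lipc: "1-lipschitz_on UNIV c"
      unfolding c_def using \<rho> by (intro lipschitz_onI) (auto intro!: closest_point_lipschitz)
    have lipG: "(C * 1)-lipschitz_on UNIV G"
      unfolding G_def
      by (rule lipschitz_on_compose2[OF lipc lipschitz_on_subset[OF lip]]) (use c in blast)
    have "compact (F ` cball q \<rho>)"
      by (intro compact_continuous_image lipschitz_on_continuous_on[OF lip]) auto
    then obtain B where "\<And>p. p \<in> cball q \<rho> \<Longrightarrow> norm (F p) \<le> B"
      using compact_imp_bounded bounded_iff by (metis image_eqI)
    then have bndG: "norm (G p) \<le> B" for p using c by (simp add: G_def)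
    obtain x where x: "x 0 = y"
      "\<And>t. 0 \<le> t \<Longrightarrow> (x has_vector_derivative G (x t)) (at t within {0..})"
      using bounded_lipschitz_field_global_solution[OF lipG bndG] by blast
    have GF: "G p = F p" if "p \<in> cball q \<rho>" for p
      using that by (simp add: G_def c_def closest_point_self)
    have gx: "g (x t) = g q" if "0 \<le> t" for t
    proof -
      have "((\<lambda>t. g (x t)) has_real_derivative 0) (at s within {0..})" if "0 \<le> s" for s
        using bounded_linear.has_vector_derivative[OF g x(2)[OF that]] gF[OF c]
        by (simp add: has_real_derivative_iff_has_vector_derivative G_def)
      then have "\<exists>k. \<forall>s\<in>{0..}. g (x s) = k"
        by (intro has_field_derivative_zero_constant) auto
      then have "g (x t) = g (x 0)" using that by auto
      then show ?thesis using gX[OF y(1)] x(1) by simp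
    qed
    have inball: "dist (x t) q < \<rho>" if "0 \<le> t" for t
      using trapped(2)[OF GF x(2) gx _ that] \<delta>(2)[OF y] x(1) by blast
    have xF: "(x has_vector_derivative F (x t)) (at t within {0..})" if "0 \<le> t" for t
      using x(2)[OF that] GF[of "x t"] inball[OF that] by (simp add: dist_commute)
    have "x t \<in> X" if "0 \<le> t" for t
    proof (rule invariant[of x])
      show "x s \<in> cball q \<rho> \<and> g (x s) = g q" if "0 \<le> s" for s
        using inball[OF that] gx[OF that] by (simp add: dist_commute)
    qed (use x(1) y(1) that xF in auto)
    then show ?thesis using x(1) xF by (auto simp: forward_solution_def)
  qed
  have stable: "\<exists>\<delta>'>0. \<forall>y\<in>X. dist y q < \<delta>' \<longrightarrow>
        (\<forall>x. forward_solution F X y x \<longrightarrow> (\<forall>t\<ge>0. dist (x t) q < \<epsilon>))" if "0 < \<epsilon>" for \<epsilon>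
  proof -
    have "0 < min \<eta> (m * \<epsilon>\<^sup>2)" using \<eta>0 m that by simp
    then obtain \<delta>' where \<delta>': "0 < \<delta>'" "\<And>y. y \<in> X \<Longrightarrow> dist y q < \<delta>' \<Longrightarrow> V y < min \<eta> (m * \<epsilon>\<^sup>2)"
      using start gX by blast
    have "dist (x t) q < \<epsilon>" if "y \<in> X" "dist y q < \<delta>'" "forward_solution F X y x" "0 \<le> t" for x y t
    proof (rule near[OF _ _ \<open>0 < \<epsilon>\<close>])
      show "g (x t) = g q" using that gX by (auto simp: forward_solution_def)
      have x0: "x 0 = y" using that by (simp add: forward_solution_def)
      have "V (x t) \<le> V y * exp (- \<gamma> * t)"
        using sol[OF that(3) _ that(4)] \<delta>'(2)[OF that(1,2)] x0 by simp
      also have "\<dots> \<le> V y"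
        using V0[OF gX[OF that(1)]] \<gamma> that(4) by (simp add: mult_left_le)
      also have "\<dots> < m * \<epsilon>\<^sup>2" using \<delta>'(2)[OF that(1,2)] by simp
      finally show "V (x t) < m * \<epsilon>\<^sup>2" .
    qed
    then show ?thesis using \<delta>'(1) by blast
  qed
  have attract: "(x \<longlongrightarrow> q) at_top" if "y \<in> X" "dist y q < \<delta>" "forward_solution F X y x" for x y
  proof (rule tendstoI)
    fix \<epsilon> :: real assume \<epsilon>: "0 < \<epsilon>"
    have "((\<lambda>t. V y * exp (- \<gamma> * t)) \<longlongrightarrow> V y * 0) at_top"
      using \<gamma> by (intro tendsto_mult tendsto_const filterlim_compose[OF exp_at_bot]
          filterlim_tendsto_neg_mult_at_bot[OF tendsto_const] filterlim_ident) auto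
    then have "\<forall>\<^sub>F t in at_top. V y * exp (- \<gamma> * t) < m * \<epsilon>\<^sup>2"
      using \<epsilon> m by (intro order_tendstoD(2)[where y = "V y * 0"]) auto
    then show "\<forall>\<^sub>F t in at_top. dist (x t) q < \<epsilon>"
      using eventually_ge_at_top[of 0]
    proof eventually_elim
      case (elim t)
      have x0: "x 0 = y" and "g (x t) = g q" using that elim(2) gX by (auto simp: forward_solution_def)
      then show ?case
        using sol[OF that(3) \<delta>(2)[OF that(1,2)] elim(2)] elim(1) by (intro near \<epsilon>) auto
    qed
  qed
  show ?thesis
    unfolding locally_asymptotically_stable_def
    using q existence stable attract \<delta>(1) by blast
qed

section \<open>Functions that are Lipschitz near a point\<close>

lemma eventually_small_cball:
  fixes q :: "'a::metric_space"
  assumes "\<forall>\<^sub>F p in nhds q. Q p"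
  shows "\<forall>\<^sub>F \<rho> in at_right 0. \<forall>p\<in>cball q \<rho>. Q p"
proof -
  obtain d where "0 < d" "\<And>p. dist p q < d \<Longrightarrow> Q p"
    using assms by (auto simp: eventually_nhds_metric)
  then show ?thesis unfolding eventually_at_right_field
    by (intro exI[of _ d]) (auto simp: dist_commute)
qed

lemma eventually_at_right_0_obtain:
  fixes Q :: "real \<Rightarrow> bool"
  assumes "\<forall>\<^sub>F \<rho> in at_right 0. Q \<rho>"
  obtains \<rho> where "0 < \<rho>" "Q \<rho>"
  using eventually_happens'[OF _ eventually_conj[OF assms eventually_at_right_less]] by auto

text \<open>
  Asking for one constant on all sufficiently small balls, rather than on some ball, lets the
  balls of several functions be combined by \<open>eventually_elim\<close>.
\<close>

definition lipschitz_near :: "('a::metric_space \<Rightarrow> 'b::metric_space) \<Rightarrow> 'a \<Rightarrow> bool" where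
  "lipschitz_near f q \<longleftrightarrow> (\<exists>C. \<forall>\<^sub>F \<rho> in at_right 0. C-lipschitz_on (cball q \<rho>) f)"

lemma lipschitz_near_imp_tendsto:
  assumes "lipschitz_near f q"
  shows "(f \<longlongrightarrow> f q) (nhds q)"
proof -
  obtain \<rho> C where \<rho>: "0 < \<rho>" "C-lipschitz_on (cball q \<rho>) f"
    using assms by (auto simp: lipschitz_near_def elim: eventually_at_right_0_obtain)
  then have "continuous_on (cball q \<rho>) f" by (intro lipschitz_on_continuous_on)
  then have "continuous_on (ball q \<rho>) f" by (rule continuous_on_subset) auto
  then have "isCont f q" using \<rho>(1) by (simp add: continuous_on_eq_continuous_at)
  then show ?thesis by (simp add: continuous_at tendsto_at_iff_tendsto_nhds)
qed

lemma lipschitz_on_imp_near: "C-lipschitz_on UNIV f \<Longrightarrow> lipschitz_near f q"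
  unfolding lipschitz_near_def
  by (intro exI[of _ C] always_eventually allI) (rule lipschitz_on_subset, auto)

lemma lipschitz_near_const: "lipschitz_near (\<lambda>x. c) q"
  by (rule lipschitz_on_imp_near[OF lipschitz_on_constant])

lemma lipschitz_near_vec_nth: "lipschitz_near (\<lambda>p :: real^'n. p $ r) q"
  by (rule lipschitz_on_imp_near[where C = 1], rule lipschitz_onI)
    (auto simp: dist_vec_nth_le)

lemma lipschitz_near_add:
  fixes f g :: "'a::metric_space \<Rightarrow> 'b::real_normed_vector"
  assumes "lipschitz_near f q" "lipschitz_near g q"
  shows "lipschitz_near (\<lambda>x. f x + g x) q"
proof -
  obtain C D where "\<forall>\<^sub>F \<rho> in at_right 0. C-lipschitz_on (cball q \<rho>) f"
    "\<forall>\<^sub>F \<rho> in at_right 0. D-lipschitz_on (cball q \<rho>) g"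
    using assms by (auto simp: lipschitz_near_def)
  then have "\<forall>\<^sub>F \<rho> in at_right 0. (C+D)-lipschitz_on (cball q \<rho>) (\<lambda>x. f x + g x)"
    by eventually_elim (rule lipschitz_on_add)
  then show ?thesis by (auto simp: lipschitz_near_def)
qed

lemma lipschitz_near_mult:
  fixes f g :: "'a::metric_space \<Rightarrow> real"
  assumes f: "lipschitz_near f q" and g: "lipschitz_near g q"
  shows "lipschitz_near (\<lambda>x. f x * g x) q"
proof -
  define Bf Bg where "Bf = \<bar>f q\<bar> + 1" and "Bg = \<bar>g q\<bar> + 1"
  have "\<forall>\<^sub>F x in nhds q. \<bar>f x\<bar> < Bf" "\<forall>\<^sub>F x in nhds q. \<bar>g x\<bar> < Bg"
    by (rule order_tendstoD(2)[OF tendsto_rabs[OF lipschitz_near_imp_tendsto]];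
        use f g in \<open>simp add: Bf_def Bg_def\<close>)+
  note bounds = this[THEN eventually_small_cball]
  obtain C D where "\<forall>\<^sub>F \<rho> in at_right 0. C-lipschitz_on (cball q \<rho>) f"
    "\<forall>\<^sub>F \<rho> in at_right 0. D-lipschitz_on (cball q \<rho>) g"
    using assms by (auto simp: lipschitz_near_def)
  with bounds have "\<forall>\<^sub>F \<rho> in at_right 0. (Bf * D + Bg * C)-lipschitz_on (cball q \<rho>) (\<lambda>x. f x * g x)"
  proof eventually_elim
    case (elim \<rho>)
    have B0: "0 \<le> Bf" "0 \<le> Bg" by (auto simp: Bf_def Bg_def)
    show ?case
    proof (rule lipschitz_onI)
      fix x y assume xy: "x \<in> cball q \<rho>" "y \<in> cball q \<rho>"
      have "\<bar>f x * g x - f y * g y\<bar> = \<bar>f x * (g x - g y) + g y * (f x - f y)\<bar>"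
        by (simp add: algebra_simps)
      also have "\<dots> \<le> \<bar>f x\<bar> * \<bar>g x - g y\<bar> + \<bar>g y\<bar> * \<bar>f x - f y\<bar>"
        by (metis abs_mult abs_triangle_ineq)
      also have "\<dots> \<le> Bf * (D * dist x y) + Bg * (C * dist x y)"
        using elim xy B0 lipschitz_onD[OF elim(3) xy] lipschitz_onD[OF elim(4) xy]
        by (intro add_mono mult_mono) (auto simp: dist_real_def less_imp_le)
      finally show "dist (f x * g x) (f y * g y) \<le> (Bf * D + Bg * C) * dist x y"
        by (simp add: dist_real_def algebra_simps)
    qed (use B0 elim(3,4)[THEN lipschitz_on_nonneg] in auto)
  qed
  then show ?thesis by (auto simp: lipschitz_near_def)
qed

lemma lipschitz_near_inverse:
  fixes g :: "'a::metric_space \<Rightarrow> real"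
  assumes g: "lipschitz_near g q" and "g q \<noteq> 0"
  shows "lipschitz_near (\<lambda>x. inverse (g x)) q"
proof -
  define b where "b = \<bar>g q\<bar> / 2"
  have b0: "0 < b" using assms(2) by (simp add: b_def)
  have "\<forall>\<^sub>F x in nhds q. b < \<bar>g x\<bar>"
    by (rule order_tendstoD(1)[OF tendsto_rabs[OF lipschitz_near_imp_tendsto[OF g]]])
      (use assms(2) in \<open>simp add: b_def\<close>)
  note bound = this[THEN eventually_small_cball]
  obtain C where "\<forall>\<^sub>F \<rho> in at_right 0. C-lipschitz_on (cball q \<rho>) g"
    using assms by (auto simp: lipschitz_near_def)
  with bound have "\<forall>\<^sub>F \<rho> in at_right 0. (C / b\<^sup>2)-lipschitz_on (cball q \<rho>) (\<lambda>x. inverse (g x))"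
  proof eventually_elim
    case (elim \<rho>)
    show ?case
    proof (rule lipschitz_onI)
      fix x y assume xy: "x \<in> cball q \<rho>" "y \<in> cball q \<rho>"
      have g: "b \<le> \<bar>g x\<bar>" "b \<le> \<bar>g y\<bar>" using elim(1) xy by (auto simp: less_imp_le)
      have "dist (inverse (g x)) (inverse (g y)) = \<bar>g x - g y\<bar> / (\<bar>g x\<bar> * \<bar>g y\<bar>)"
      proof -
        have "inverse (g x) - inverse (g y) = (g y - g x) / (g x * g y)"
          using g b0 by (simp add: field_simps)
        then show ?thesis
          by (simp add: dist_real_def abs_divide abs_mult abs_minus_commute)
      qed
      also have "\<dots> \<le> (C * dist x y) / (b * b)"
        using g b0 lipschitz_onD[OF elim(2) xy] by (intro frac_le mult_mono) (auto simp: dist_real_def)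
      finally show "dist (inverse (g x)) (inverse (g y)) \<le> C / b\<^sup>2 * dist x y"
        by (simp add: power2_eq_square)
    qed (use elim(2)[THEN lipschitz_on_nonneg] in auto)
  qed
  then show ?thesis by (auto simp: lipschitz_near_def)
qed

lemma lipschitz_near_vec_lambda:
  fixes f :: "'a::metric_space \<Rightarrow> real^'n"
  assumes "\<And>r. lipschitz_near (\<lambda>x. f x $ r) q"
  shows "lipschitz_near f q"
proof -
  obtain C where "\<And>r. \<forall>\<^sub>F \<rho> in at_right 0. (C r)-lipschitz_on (cball q \<rho>) (\<lambda>x. f x $ r)"
    using assms unfolding lipschitz_near_def by metis
  then have "\<forall>\<^sub>F \<rho> in at_right 0. \<forall>r. (C r)-lipschitz_on (cball q \<rho>) (\<lambda>x. f x $ r)"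
    by (rule eventually_all_finite)
  then have "\<forall>\<^sub>F \<rho> in at_right 0. (\<Sum>r\<in>UNIV. C r)-lipschitz_on (cball q \<rho>) f"
  proof eventually_elim
    case (elim \<rho>)
    show ?case
    proof (rule lipschitz_onI)
      fix x y assume xy: "x \<in> cball q \<rho>" "y \<in> cball q \<rho>"
      have "dist (f x) (f y) \<le> (\<Sum>r\<in>UNIV. \<bar>(f x - f y) $ r\<bar>)"
        unfolding dist_norm by (rule norm_le_l1_cart)
      also have "\<dots> \<le> (\<Sum>r\<in>UNIV. C r * dist x y)"
        by (rule sum_mono) (use lipschitz_onD[OF elim[rule_format] xy] in \<open>simp add: dist_real_def\<close>)
      finally show "dist (f x) (f y) \<le> (\<Sum>r\<in>UNIV. C r) * dist x y" by (simp add: sum_distrib_right)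
    qed (use elim lipschitz_on_nonneg in \<open>blast intro: sum_nonneg\<close>)
  qed
  then show ?thesis by (auto simp: lipschitz_near_def)
qed

section \<open>The vector field near an edge of the triangle\<close>

lemma price_triangle_iff: "p \<in> price_triangle \<longleftrightarrow> (\<Sum>r\<in>UNIV. p $ r) = 1 \<and> (\<forall>r. 0 \<le> p $ r)"
  by (simp add: price_triangle_def sum_3 forall_3)

lemma Bmat_nth: "Bmat $ r $ c = (if r = c then 0 else 1)"
  using exhaust_3[of r] exhaust_3[of c] by (auto simp: Bmat_def)

text \<open>
  The endowment matrix keeps its form when indices and parameters \<open>d\<^sub>1, d\<^sub>2, d\<^sub>3\<close> are rotated
  together, while \<open>K\<close> and \<open>L\<close> stay in place.  The locale fixes the edge \<open>p$i = 0\<close> with \<open>(i, j, k)\<close>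
  standing for any of the three rotations of \<open>(1, 2, 3)\<close>, so each edge needs one interpretation
  and no separate computation.
\<close>

locale scarf_edge =
  fixes A :: "real^3^3" and i j k :: 3 and di dj dk K L :: real
  assumes distinct: "i \<noteq> j" "j \<noteq> k" "k \<noteq> i"
    and col_i: "A $ i $ i = di" "A $ j $ i = dk + K" "A $ k $ i = dj + L"
    and col_j: "A $ i $ j = dk + L" "A $ j $ j = dj" "A $ k $ j = di + K"
    and col_k: "A $ i $ k = dj + K" "A $ j $ k = di + L" "A $ k $ k = dk"
    and total: "di + dj + dk + K + L = 1"
    and pos: "0 < di" "0 < dj" "0 < dk"
begin

lemma UNIV_ijk: "(UNIV :: 3 set) = {i, j, k}"
  using distinct by (intro card_subset_eq[symmetric]) auto

lemma sum_ijk: "(\<Sum>r\<in>UNIV. f r) = f i + f j + f k" for f :: "3 \<Rightarrow> 'a::comm_monoid_add"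
  using distinct by (simp add: UNIV_ijk add.assoc)

lemma all_ijk: "(\<forall>r. Q r) \<longleftrightarrow> Q i \<and> Q j \<and> Q k"
  by (metis UNIV_I UNIV_ijk empty_iff insert_iff)

lemma demand_ratio_ijk:
  "demand_ratio A p $ i = (p$i * di + p$j * (dk + K) + p$k * (dj + L)) / (p$j + p$k)"
  "demand_ratio A p $ j = (p$i * (dk + L) + p$j * dj + p$k * (di + K)) / (p$i + p$k)"
  "demand_ratio A p $ k = (p$i * (dj + K) + p$j * (di + L) + p$k * dk) / (p$i + p$j)"
  using distinct
  by (simp_all add: demand_ratio_def column_def inner_vec_def sum_ijk Bmat_nth col_i col_j col_k)

lemma excess_demand_ijk:
  "excess_demand A p $ i = demand_ratio A p $ j + demand_ratio A p $ k - 1"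
  "excess_demand A p $ j = demand_ratio A p $ i + demand_ratio A p $ k - 1"
  "excess_demand A p $ k = demand_ratio A p $ i + demand_ratio A p $ j - 1"
proof -
  have u: "uvec $ r = 1" for r using exhaust_3[of r] by (auto simp: uvec_def)
  show
    "excess_demand A p $ i = demand_ratio A p $ j + demand_ratio A p $ k - 1"
    "excess_demand A p $ j = demand_ratio A p $ i + demand_ratio A p $ k - 1"
    "excess_demand A p $ k = demand_ratio A p $ i + demand_ratio A p $ j - 1"
    using distinct total
    by (simp_all add: excess_demand_def matrix_vector_mult_def sum_ijk Bmat_nth u col_i col_j col_k)
qed

lemma price_field_nth: "price_field A p $ r = p $ r * excess_demand A p $ r"
  by (simp add: price_field_def)

text \<open>
  Walras' law: \<open>p \<bullet> E(p) = 0\<close>, because each consumer's demand exhausts the value of the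
  endowment, and the endowments add up to \<open>(1, 1, 1)\<close>.  Only the denominators enter, so the law holds on a full
  neighbourhood of an edge point, outside the triangle and off the plane of normalized prices.
\<close>

lemma walras:
  assumes "p$i + p$j \<noteq> 0" "p$j + p$k \<noteq> 0" "p$i + p$k \<noteq> 0"
  shows "(\<Sum>r\<in>UNIV. price_field A p $ r) = 0"
proof -
  have "demand_ratio A p $ i * (p$j + p$k) = p$i * di + p$j * (dk + K) + p$k * (dj + L)"
    "demand_ratio A p $ j * (p$i + p$k) = p$i * (dk + L) + p$j * dj + p$k * (di + K)"
    "demand_ratio A p $ k * (p$i + p$j) = p$i * (dj + K) + p$j * (di + L) + p$k * dk"
    using assms by (simp_all add: demand_ratio_ijk)
  moreover have "K = 1 - di - dj - dk - L" using total by simp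
  ultimately show ?thesis
    by (simp add: sum_ijk price_field_nth excess_demand_ijk) algebra
qed

lemma excess_demand_lipschitz_near:
  assumes "q$i + q$j \<noteq> 0" "q$j + q$k \<noteq> 0" "q$i + q$k \<noteq> 0"
  shows "lipschitz_near (\<lambda>p. excess_demand A p $ r) q"
proof -
  have "lipschitz_near (\<lambda>p. demand_ratio A p $ i) q"
    "lipschitz_near (\<lambda>p. demand_ratio A p $ j) q" "lipschitz_near (\<lambda>p. demand_ratio A p $ k) q"
    unfolding demand_ratio_ijk divide_inverse using assms
    by (intro lipschitz_near_mult lipschitz_near_add lipschitz_near_inverse lipschitz_near_const
        lipschitz_near_vec_nth; simp)+
  then have "\<forall>r. lipschitz_near (\<lambda>p. excess_demand A p $ r) q"
    unfolding all_ijk excess_demand_ijk diff_conv_add_uminus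
    by (intro conjI lipschitz_near_add lipschitz_near_const)
  then show ?thesis by blast
qed

lemma price_field_lipschitz_near:
  assumes "q$i + q$j \<noteq> 0" "q$j + q$k \<noteq> 0" "q$i + q$k \<noteq> 0"
  shows "lipschitz_near (price_field A) q"
  by (rule lipschitz_near_vec_lambda)
    (unfold price_field_nth, intro lipschitz_near_mult lipschitz_near_vec_nth
      excess_demand_lipschitz_near assms)

text \<open>
  On the edge the two rational terms of the field combine to a quadratic polynomial
  in \<open>s = p$j\<close>.  It is positive at 0 and negative at 1.
\<close>

definition edge_velocity :: "real \<Rightarrow> real" where
  "edge_velocity s = (L - K) * s * (1 - s) + dk * (1 - s)\<^sup>2 - dj * s\<^sup>2"

lemma price_field_on_edge:
  assumes "p$i = 0" "p$j = s" "p$k = 1 - s" "0 < s" "s < 1"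
  shows "price_field A p $ j = edge_velocity s"
proof -
  have K: "di = 1 - K - dj - dk - L" using total by simp
  show ?thesis
    using assms(4,5) unfolding price_field_nth excess_demand_ijk demand_ratio_ijk assms(1-3) K edge_velocity_def
    by (simp add: divide_simps) algebra
qed

text \<open>
  Both sides are quadratic polynomials in \<open>s\<close> that agree at 0, 1 and \<open>q\<close>.  Since the last factor
  is positive on the unit interval, the flow on the edge runs towards \<open>q\<close> from both sides; in particular
  only the direction transversal to the edge decides about stability.
\<close>

lemma edge_velocity_factor:
  assumes "edge_velocity q = 0" "0 < q" "q < 1"
  shows "edge_velocity s = - (s - q) * (dk / q * (1 - s) + dj / (1 - q) * s)"
proof -
  have "L - K = (dj * q\<^sup>2 - dk * (1 - q)\<^sup>2) / (q * (1 - q))"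
    using assms by (simp add: edge_velocity_def field_simps)
  then show ?thesis
    using assms(2,3) unfolding edge_velocity_def
    by (simp add: divide_simps) algebra
qed

lemma open_edge_iff:
  "p \<in> open_edge i \<longleftrightarrow> p$i = 0 \<and> p$k = 1 - p$j \<and> 0 < p$j \<and> p$j < 1"
  using distinct by (auto simp: open_edge_def price_triangle_iff sum_ijk all_ijk)

lemma punctured_triangleI:
  assumes "0 \<le> p$i" "0 < p$j" "0 < p$k" "(\<Sum>r\<in>UNIV. p $ r) = 1"
  shows "p \<in> punctured_triangle"
proof -
  have "p \<noteq> axis r 1" for r
    using assms(2,3) distinct by (auto simp: axis_def split: if_splits)
  then show ?thesis
    using assms by (auto simp: punctured_triangle_def price_triangle_iff all_ijk)
qed

lemma edge_fixed_point_iff: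
  assumes q: "q \<in> open_edge i"
  shows "price_field A q = 0 \<longleftrightarrow> edge_velocity (q$j) = 0"
proof -
  have q': "q$i = 0" "q$k = 1 - q$j" "0 < q$j" "q$j < 1" using q by (auto simp: open_edge_iff)
  have j: "price_field A q $ j = edge_velocity (q$j)" by (rule price_field_on_edge) (use q' in auto)
  have i: "price_field A q $ i = 0" using q' by (simp add: price_field_nth)
  have "(\<Sum>r\<in>UNIV. price_field A q $ r) = 0" by (rule walras) (use q' in auto)
  then have "price_field A q $ k = - price_field A q $ j" using i by (simp add: sum_ijk)
  then show ?thesis using i j by (simp add: vec_eq_iff all_ijk)
qed

lemma edge_fixed_point_exists: "\<exists>q \<in> open_edge i. price_field A q = 0"
proof -
  have "\<exists>s\<ge>0. s \<le> 1 \<and> edge_velocity s = 0"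
    using pos by (intro IVT2) (auto simp: edge_velocity_def intro!: continuous_intros)
  then obtain s where s: "0 \<le> s" "s \<le> 1" "edge_velocity s = 0" by blast
  have "s \<noteq> 0" "s \<noteq> 1" using s(3) pos by (auto simp: edge_velocity_def)
  define q :: "real^3" where "q = (\<chi> r. if r = i then 0 else if r = j then s else 1 - s)"
  have "q \<in> open_edge i" "q $ j = s"
    using s \<open>s \<noteq> 0\<close> \<open>s \<noteq> 1\<close> distinct by (auto simp: open_edge_iff q_def)
  then show ?thesis using s(3) edge_fixed_point_iff by auto
qed

text \<open>
  The eigenvalue of the linearization transversal to the edge is \<open>E\<^sub>i(q)\<close>.  With
  \<open>a = dj * s / (1 - s)\<close> and \<open>b = dk * (1 - s) / s\<close> the fixed point equation reads \<open>a - b = L - K\<close>,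
  the product \<open>a * b = dj * dk\<close> does not depend on \<open>s\<close>, and \<open>E\<^sub>i(q) = di - dj - dk + (a + b)\<close>.
  So \<open>\<sigma> = a + b\<close> is found without solving the quadratic equation for \<open>s\<close>.
\<close>

lemma transversal_rate:
  assumes q: "q \<in> open_edge i" and "price_field A q = 0"
  obtains \<sigma> where "0 < \<sigma>" "\<sigma>\<^sup>2 = (K - L)\<^sup>2 + 4 * dj * dk"
    "excess_demand A q $ i = di - dj - dk + \<sigma>"
proof -
  define s where "s = q$j"
  have q': "q$i = 0" "q$j = s" "q$k = 1 - s" "0 < s" "s < 1" using q by (auto simp: open_edge_iff s_def)
  have ev: "edge_velocity s = 0" using assms edge_fixed_point_iff by (simp add: s_def)
  define a b where "a = dj * s / (1 - s)" and "b = dk * (1 - s) / s"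
  have "a - b = L - K" using ev q'(4,5)
    by (simp add: a_def b_def edge_velocity_def field_simps power2_eq_square)
  moreover have "a * b = dj * dk" using q'(4,5) by (simp add: a_def b_def)
  moreover have "(a + b)\<^sup>2 = (a - b)\<^sup>2 + 4 * (a * b)" by algebra
  ultimately have "(a + b)\<^sup>2 = (K - L)\<^sup>2 + 4 * dj * dk" by (simp add: power2_commute)
  moreover have "0 < a + b" using q'(4,5) pos by (simp add: a_def b_def add_pos_pos)
  moreover have "excess_demand A q $ i = di - dj - dk + (a + b)"
  proof -
    have "demand_ratio A q $ j = a + di + K" "demand_ratio A q $ k = b + di + L"
      using q'(4,5) unfolding demand_ratio_ijk q'(1-3) a_def b_def by (simp_all add: field_simps)
    then show ?thesis using total by (simp add: excess_demand_ijk)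
  qed
  ultimately show thesis using that by blast
qed

section \<open>Stability is decided by the transversal rate\<close>

lemma dist_sq_ijk: "(dist p q)\<^sup>2 = (p$i - q$i)\<^sup>2 + (p$j - q$j)\<^sup>2 + (p$k - q$k)\<^sup>2" for p q :: "real^3"
  unfolding dist_norm power2_norm_eq_inner inner_vec_def sum_ijk by (simp add: power2_eq_square)

text \<open>
  In the coordinates \<open>u = p$i\<close> and \<open>v = p$j - q$j\<close> of the plane \<open>p$i + p$j + p$k = 1\<close> the Lyapunov function
  is \<open>M * u\<^sup>2 + v\<^sup>2\<close>.  The field contracts \<open>u\<close> at rate \<open>c\<close>, because \<open>E\<^sub>i\<close> is negative near \<open>q\<close>, and it
  contracts \<open>v\<close> at rate \<open>a\<close> on the edge.  Off the edge the \<open>v\<close> component is perturbed by at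
  most a multiple of \<open>\<bar>u\<bar>\<close>, since the field is Lipschitz, and a large weight \<open>M\<close> absorbs the
  resulting mixed term.  The function is even in \<open>u\<close>, so that it also controls the points outside the triangle.
\<close>

lemma attracting_edge_fixed_point_stable:
  assumes q: "q \<in> open_edge i" and fixed: "price_field A q = 0"
    and rate: "excess_demand A q $ i < 0"
  shows "locally_asymptotically_stable (price_field A) punctured_triangle q"
proof -
  define s where "s = q$j"
  have q': "q$i = 0" "q$j = s" "q$k = 1 - s" "0 < s" "s < 1" using q by (auto simp: open_edge_iff s_def)
  have ev: "edge_velocity s = 0" using edge_fixed_point_iff[OF q] fixed by (simp add: s_def)
  have nz: "q$i + q$j \<noteq> 0" "q$j + q$k \<noteq> 0" "q$i + q$k \<noteq> 0" using q' by auto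
  define c where "c = - excess_demand A q $ i / 2"
  have c: "0 < c" using rate by (simp add: c_def)
  \<comment> \<open>lower bound on the unit interval of the linear factor in \<open>edge_velocity_factor\<close>, which
    interpolates between the two arguments of the minimum\<close>
  define a where "a = min (dk / s) (dj / (1 - s))"
  have a: "0 < a" using pos q' by (simp add: a_def)
  obtain C where C: "\<forall>\<^sub>F \<rho> in at_right 0. C-lipschitz_on (cball q \<rho>) (price_field A)"
    using price_field_lipschitz_near[OF nz] by (auto simp: lipschitz_near_def)
  then obtain \<rho>1 where \<rho>1: "0 < \<rho>1" "C-lipschitz_on (cball q \<rho>1) (price_field A)"
    by (rule eventually_at_right_0_obtain)
  obtain D where D: "\<forall>\<^sub>F \<rho> in at_right 0. D-lipschitz_on (cball q \<rho>) (\<lambda>p. excess_demand A p $ i)"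
    using excess_demand_lipschitz_near[OF nz] by (auto simp: lipschitz_near_def)
  have "\<forall>\<^sub>F p in nhds q. excess_demand A p $ i < - c"
    by (rule order_tendstoD(2)[OF lipschitz_near_imp_tendsto[OF excess_demand_lipschitz_near[OF nz]]])
      (use rate in \<open>simp add: c_def\<close>)
  note D this[THEN eventually_small_cball]
  moreover have "\<forall>\<^sub>F \<rho> in at_right (0::real). \<rho> < min (\<rho>1 / 3) (min (s / 2) ((1 - s) / 2))"
    using \<rho>1 q' by (intro eventually_at_rightI[of 0 "min (\<rho>1 / 3) (min (s / 2) ((1 - s) / 2))"]) auto
  ultimately have "\<forall>\<^sub>F \<rho> in at_right 0. D-lipschitz_on (cball q \<rho>) (\<lambda>p. excess_demand A p $ i)
      \<and> (\<forall>p\<in>cball q \<rho>. excess_demand A p $ i < - c) \<and> \<rho> < min (\<rho>1 / 3) (min (s / 2) ((1 - s) / 2))"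
    by eventually_elim blast
  \<comment> \<open>\<open>3 * \<rho> < \<rho>1\<close> leaves room to move a point of the small ball by \<open>2 * \<bar>u\<bar>\<close> onto the edge
    line; the last two bounds keep \<open>p$j\<close> and \<open>p$k\<close> positive and the denominators nonzero\<close>
  then obtain \<rho> where \<rho>: "0 < \<rho>" "D-lipschitz_on (cball q \<rho>) (\<lambda>p. excess_demand A p $ i)"
    "\<And>p. p \<in> cball q \<rho> \<Longrightarrow> excess_demand A p $ i < - c"
    "3 * \<rho> < \<rho>1" "2 * \<rho> < s" "2 * \<rho> < 1 - s"
    by (rule eventually_at_right_0_obtain) force
  \<comment> \<open>\<open>2 * C\<close> bounds the perturbation of the \<open>v\<close> component per unit of \<open>\<bar>u\<bar>\<close>; \<open>M \<ge> 1\<close> is for the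
    lower bound of the Lyapunov function\<close>
  define M where "M = max 1 ((2 * C)\<^sup>2 / (a * c))"
  have M: "1 \<le> M" "(2 * C)\<^sup>2 / a \<le> M * c"
  proof -
    show "1 \<le> M" by (simp add: M_def)
    have "(2 * C)\<^sup>2 / (a * c) * c \<le> M * c" using c by (intro mult_right_mono) (auto simp: M_def)
    then show "(2 * C)\<^sup>2 / a \<le> M * c" using c by simp
  qed
  have coords: "\<bar>p$i\<bar> \<le> \<rho>" "\<bar>p$j - s\<bar> \<le> \<rho>" "\<bar>p$k - (1 - s)\<bar> \<le> \<rho>" if "p \<in> cball q \<rho>" for p
    using that dist_vec_nth_le[of p i q] dist_vec_nth_le[of p j q] dist_vec_nth_le[of p k q] q'
    by (auto simp: dist_real_def dist_commute)
  define V where "V p = M * (p$i)\<^sup>2 + (p$j - s)\<^sup>2" for p :: "real^3"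
  define DV where "DV p h = 2 * M * p$i * h$i + 2 * (p$j - s) * h$j" for p h :: "real^3"
  have dist_plane: "(dist p q)\<^sup>2 = (p$i)\<^sup>2 + (p$j - s)\<^sup>2 + (p$i + (p$j - s))\<^sup>2"
    if "(\<Sum>r\<in>UNIV. p $ r) = (\<Sum>r\<in>UNIV. q $ r)" for p
  proof -
    have "p$k - (1 - s) = - (p$i + (p$j - s))" using that by (simp add: sum_ijk q')
    then show ?thesis unfolding dist_sq_ijk q' by (simp only: power2_minus diff_0_right)
  qed
  show ?thesis
  proof (rule lyapunov_asymptotic_stability[where \<rho> = \<rho> and g = "\<lambda>p. \<Sum>r\<in>UNIV. p $ r"
        and V = V and DV = DV and m = "1/3" and M = M and \<gamma> = "min c a"])
    show "q \<in> punctured_triangle" by (rule punctured_triangleI) (use q' in \<open>auto simp: sum_ijk\<close>)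
    show "price_field A q = 0" by (rule fixed)
    show "C-lipschitz_on (cball q \<rho>) (price_field A)"
      using \<rho> by (intro lipschitz_on_subset[OF \<rho>1(2)]) auto
    show "0 < \<rho>" by (rule \<rho>(1))
    show "bounded_linear (\<lambda>p :: real^3. \<Sum>r\<in>UNIV. p $ r)" 
      by (intro bounded_linear_sum bounded_linear_vec_nth)
    show "(\<Sum>r\<in>UNIV. p $ r) = (\<Sum>r\<in>UNIV. q $ r)" if "p \<in> punctured_triangle" for p
      using that q' by (auto simp: punctured_triangle_def price_triangle_iff sum_ijk)
    show "(\<Sum>r\<in>UNIV. price_field A p $ r) = 0" if "p \<in> cball q \<rho>" for p
      using coords[OF that] \<rho> q' by (intro walras) auto
    show "(V has_derivative DV p) (at p)" for p
      unfolding V_def DV_def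
      by (auto intro!: derivative_eq_intros bounded_linear.has_derivative[OF bounded_linear_vec_nth]
          simp: algebra_simps)
    show "1/3 * (dist p q)\<^sup>2 \<le> V p" if "(\<Sum>r\<in>UNIV. p $ r) = (\<Sum>r\<in>UNIV. q $ r)" for p
    proof -
      have "(p$i + (p$j - s))\<^sup>2 \<le> 2 * (p$i)\<^sup>2 + 2 * (p$j - s)\<^sup>2"
        using zero_le_power2[of "p$i - (p$j - s)"] by (simp add: power2_eq_square algebra_simps)
      moreover have "(p$i)\<^sup>2 \<le> M * (p$i)\<^sup>2" using M(1) by (simp add: mult_le_cancel_right1)
      moreover have "0 \<le> (p$j - s)\<^sup>2" by simp
      ultimately show ?thesis unfolding dist_plane[OF that] V_def by argo
    qed
    show "0 < (1/3 :: real)" by simp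
    show "V p \<le> M * (dist p q)\<^sup>2" if "(\<Sum>r\<in>UNIV. p $ r) = (\<Sum>r\<in>UNIV. q $ r)" for p
    proof -
      have "(p$j - s)\<^sup>2 \<le> M * (p$j - s)\<^sup>2" using M(1) by (simp add: mult_le_cancel_right1)
      moreover have "0 \<le> M * (p$i + (p$j - s))\<^sup>2" using M(1) by simp
      ultimately show ?thesis unfolding dist_plane[OF that] V_def by (simp add: distrib_left)
    qed
    show "0 < min c a" using a c by simp
  next
    fix p assume p: "p \<in> cball q \<rho>" and plane: "(\<Sum>r\<in>UNIV. p $ r) = (\<Sum>r\<in>UNIV. q $ r)"
    define u v where "u = p$i" and "v = p$j - s"
    note p' = coords[OF p]
    \<comment> \<open>shadow of \<open>p\<close> on the line through the edge, with the same \<open>j\<close> coordinate\<close>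
    define p0 where "p0 = p + u *\<^sub>R (axis k 1 - axis i 1)"
    have p0: "p0$i = 0" "p0$j = p$j" "p0$k = 1 - p$j"
      using plane distinct by (auto simp: p0_def u_def axis_def sum_ijk q')
    have pp0: "dist p p0 \<le> 2 * \<bar>u\<bar>"
    proof -
      have "norm (axis k 1 - axis i 1 :: real^3) \<le> 2"
        using norm_triangle_ineq4[of "axis k 1 :: real^3" "axis i 1"] by simp
      then have "\<bar>u\<bar> * norm (axis k 1 - axis i 1 :: real^3) \<le> \<bar>u\<bar> * 2" by (intro mult_left_mono) auto
      then show ?thesis by (simp add: p0_def dist_norm)
    qed
    have "dist q p0 \<le> dist q p + dist p p0" by (rule dist_triangle)
    also have "\<dots> \<le> \<rho>1" using pp0 p' p \<rho>(4) by (auto simp: u_def)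
    finally have p0_ball: "p0 \<in> cball q \<rho>1" by simp
    have p_ball: "p \<in> cball q \<rho>1" using p \<rho> by auto
    have diff: "\<bar>price_field A p $ j - price_field A p0 $ j\<bar> \<le> 2 * C * \<bar>u\<bar>"
    proof -
      have "dist (price_field A p $ j) (price_field A p0 $ j) \<le> dist (price_field A p) (price_field A p0)"
        by (rule dist_vec_nth_le)
      also have "\<dots> \<le> C * dist p p0" by (rule lipschitz_onD[OF \<rho>1(2) p_ball p0_ball])
      also have "\<dots> \<le> C * (2 * \<bar>u\<bar>)"
        using pp0 lipschitz_on_nonneg[OF \<rho>1(2)] by (rule mult_left_mono)
      finally show ?thesis by (simp add: dist_real_def)
    qed
    have along: "v * price_field A p0 $ j \<le> - a * v\<^sup>2"
    proof -
      have s01: "0 < p$j" "p$j < 1" using p' \<rho> q' by auto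
      have "price_field A p0 $ j = edge_velocity (p$j)"
        by (rule price_field_on_edge) (use p0 s01 in auto)
      also have "\<dots> = - v * (dk / s * (1 - p$j) + dj / (1 - s) * p$j)"
        using edge_velocity_factor[OF ev q'(4,5)] by (simp add: v_def)
      finally have "v * price_field A p0 $ j = - (v\<^sup>2 * (dk / s * (1 - p$j) + dj / (1 - s) * p$j))"
        by (simp add: power2_eq_square)
      moreover have "a * (1 - p$j) + a * p$j \<le> dk / s * (1 - p$j) + dj / (1 - s) * p$j"
        using s01 by (intro add_mono mult_right_mono) (auto simp: a_def)
      then have "v\<^sup>2 * a \<le> v\<^sup>2 * (dk / s * (1 - p$j) + dj / (1 - s) * p$j)"
        by (intro mult_left_mono) (auto simp: algebra_simps)
      ultimately show ?thesis by (simp add: mult.commute)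
    qed
    have cross: "2 * (v * (price_field A p $ j - price_field A p0 $ j)) \<le> a * v\<^sup>2 + M * c * u\<^sup>2"
    proof -
      define w where "w = price_field A p $ j - price_field A p0 $ j"
      have "w\<^sup>2 \<le> (2 * C * \<bar>u\<bar>)\<^sup>2"
        using diff unfolding w_def by (metis abs_ge_zero power2_abs power_mono)
      then have "w\<^sup>2 / a \<le> (2 * C)\<^sup>2 / a * u\<^sup>2"
        using a by (simp add: divide_right_mono power_mult_distrib)
      also have "\<dots> \<le> M * c * u\<^sup>2" using M(2) by (rule mult_right_mono) simp
      finally have w: "w\<^sup>2 / a \<le> M * c * u\<^sup>2" .
      \<comment> \<open>Young's inequality, weighted so that it uses up half of the decay \<open>2 * a * v\<^sup>2\<close>\<close>
      have "0 \<le> (a * v - w)\<^sup>2 / a" using a by simp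
      also have "\<dots> = a * v\<^sup>2 - 2 * (v * w) + w\<^sup>2 / a"
        using a by (simp add: power2_eq_square field_simps)
      finally show ?thesis using w by (simp add: w_def)
    qed
    have trans: "u * price_field A p $ i \<le> - c * u\<^sup>2"
    proof -
      have "u\<^sup>2 * excess_demand A p $ i \<le> u\<^sup>2 * (- c)"
        using \<rho>(3)[OF p] by (intro mult_left_mono) auto
      then show ?thesis by (simp add: price_field_nth u_def power2_eq_square mult_ac)
    qed
    have "DV p (price_field A p) = 2 * M * (u * price_field A p $ i) + 2 * (v * price_field A p0 $ j)
        + 2 * (v * (price_field A p $ j - price_field A p0 $ j))"
      by (simp add: DV_def u_def v_def algebra_simps)
    also have "\<dots> \<le> 2 * M * (- c * u\<^sup>2) + 2 * (- a * v\<^sup>2) + (a * v\<^sup>2 + M * c * u\<^sup>2)"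
      using trans along M(1) by (intro add_mono mult_left_mono cross) auto
    also have "\<dots> = - (c * (M * u\<^sup>2) + a * v\<^sup>2)" by (simp add: algebra_simps)
    also have "\<dots> \<le> - (min c a * (M * u\<^sup>2) + min c a * v\<^sup>2)"
      using M(1) by (intro le_imp_neg_le add_mono mult_right_mono) auto
    finally show "DV p (price_field A p) \<le> - min c a * V p"
      by (simp add: V_def u_def v_def distrib_left)
  next
    fix x t
    assume x0: "x 0 \<in> punctured_triangle"
      and ball: "\<And>s. 0 \<le> s \<Longrightarrow> x s \<in> cball q \<rho> \<and> (\<Sum>r\<in>UNIV. x s $ r) = (\<Sum>r\<in>UNIV. q $ r)"
      and ode: "\<And>s. 0 \<le> s \<Longrightarrow> (x has_vector_derivative price_field A (x s)) (at s within {0..})"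
      and t: "(0::real) \<le> t"
    have "continuous_on {0..} x" by (rule halfline_derivative_imp_continuous[OF ode])
    then have cont: "continuous_on {0..} (\<lambda>s. excess_demand A (x s) $ i)"
      by (rule continuous_on_compose2[OF lipschitz_on_continuous_on[OF \<rho>(2)]]) (use ball in auto)
    have "0 \<le> x t $ i"
    proof (rule linear_ode_keeps_nonneg[OF _ cont _ t])
      show "((\<lambda>s. x s $ i) has_real_derivative x s $ i * excess_demand A (x s) $ i) (at s within {0..})"
        if "0 \<le> s" for s
        using bounded_linear.has_vector_derivative[OF bounded_linear_vec_nth ode[OF that], of i]
        by (simp add: has_real_derivative_iff_has_vector_derivative price_field_nth)
      show "0 \<le> x 0 $ i" using x0 by (simp add: punctured_triangle_def price_triangle_iff)
    qed
    then show "x t \<in> punctured_triangle"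
      using ball[OF t] coords[of "x t"] \<rho> q' by (intro punctured_triangleI) (auto simp: sum_ijk)
  qed
qed

text \<open>
  Stability would confine solutions that start in the interior near \<open>q\<close> to a neighbourhood
  on which \<open>E\<^sub>i \<ge> c > 0\<close>.  There \<open>p$i\<close> grows at least like \<open>exp (c * t)\<close>, but it is at most 1 in
  the triangle.  The existence of such solutions is part of the notion of stability.
\<close>

lemma repelling_edge_point_not_stable:
  assumes q: "q \<in> open_edge i" and rate: "0 < excess_demand A q $ i"
  shows "\<not> locally_asymptotically_stable (price_field A) punctured_triangle q"
proof
  assume las: "locally_asymptotically_stable (price_field A) punctured_triangle q"
  define s where "s = q$j"
  have q': "q$i = 0" "q$j = s" "q$k = 1 - s" "0 < s" "s < 1" using q by (auto simp: open_edge_iff s_def)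
  have nz: "q$i + q$j \<noteq> 0" "q$j + q$k \<noteq> 0" "q$i + q$k \<noteq> 0" using q' by auto
  define c where "c = excess_demand A q $ i / 2"
  have c: "0 < c" using rate by (simp add: c_def)
  have "\<forall>\<^sub>F p in nhds q. c < excess_demand A p $ i"
    by (rule order_tendstoD(1)[OF lipschitz_near_imp_tendsto[OF excess_demand_lipschitz_near[OF nz]]])
      (use rate in \<open>simp add: c_def\<close>)
  then obtain \<epsilon> where \<epsilon>: "0 < \<epsilon>" "\<And>p. dist p q < \<epsilon> \<Longrightarrow> c < excess_demand A p $ i"
    by (auto simp: eventually_nhds_metric)
  note las' = las[unfolded locally_asymptotically_stable_def]
  have "\<exists>\<delta>>0. \<forall>y\<in>punctured_triangle. dist y q < \<delta> \<longrightarrow>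
      (\<exists>x. forward_solution (price_field A) punctured_triangle y x)"
    using las' by (elim conjE)
  then obtain \<delta>1 where \<delta>1: "0 < \<delta>1" "\<And>y. y \<in> punctured_triangle \<Longrightarrow> dist y q < \<delta>1 \<Longrightarrow>
      \<exists>x. forward_solution (price_field A) punctured_triangle y x"
    by auto
  have "\<exists>\<delta>>0. \<forall>y\<in>punctured_triangle. dist y q < \<delta> \<longrightarrow>
      (\<forall>x. forward_solution (price_field A) punctured_triangle y x \<longrightarrow> (\<forall>t\<ge>0. dist (x t) q < \<epsilon>))"
    using las' \<epsilon>(1) by (elim conjE) (erule allE, erule impE)
  then obtain \<delta>2 where \<delta>2: "0 < \<delta>2" "\<And>y x t. y \<in> punctured_triangle \<Longrightarrow> dist y q < \<delta>2 \<Longrightarrow>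
      forward_solution (price_field A) punctured_triangle y x \<Longrightarrow> 0 \<le> t \<Longrightarrow> dist (x t) q < \<epsilon>"
    by auto
  \<comment> \<open>starting point: \<open>q\<close> moved by \<open>\<tau>\<close> off the edge into the triangle, at distance at most \<open>2 * \<tau>\<close>\<close>
  define \<tau> where "\<tau> = min (s / 2) (min (\<delta>1 / 3) (\<delta>2 / 3))"
  have \<tau>: "0 < \<tau>" "\<tau> < s" "2 * \<tau> < \<delta>1" "2 * \<tau> < \<delta>2"
    using q' \<delta>1(1) \<delta>2(1) by (auto simp: \<tau>_def min_def)
  define y where "y = q + \<tau> *\<^sub>R (axis i 1 - axis j 1)"
  have y': "y$i = \<tau>" "y$j = s - \<tau>" "y$k = 1 - s"
    using distinct q' by (auto simp: y_def axis_def)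
  have yX: "y \<in> punctured_triangle"
    using y' \<tau> q' by (intro punctured_triangleI) (auto simp: sum_ijk)
  have "dist y q \<le> 2 * \<tau>"
  proof -
    have "norm (axis i 1 - axis j 1 :: real^3) \<le> 2"
      using norm_triangle_ineq4[of "axis i 1 :: real^3" "axis j 1"] by simp
    then have "\<tau> * norm (axis i 1 - axis j 1 :: real^3) \<le> \<tau> * 2" using \<tau> by (intro mult_left_mono) auto
    then show ?thesis using \<tau>(1) by (simp add: y_def dist_norm)
  qed
  then have yd: "dist y q < \<delta>1" "dist y q < \<delta>2" using \<tau> by auto
  obtain x where x: "forward_solution (price_field A) punctured_triangle y x"
    using \<delta>1(2)[OF yX yd(1)] by blast
  have xi: "0 \<le> x t $ i" "x t $ i \<le> 1" if "0 \<le> t" for t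
  proof -
    have "x t \<in> price_triangle" using x that by (auto simp: forward_solution_def punctured_triangle_def)
    then show "0 \<le> x t $ i" "x t $ i \<le> 1"
      unfolding price_triangle_iff sum_ijk all_ijk by auto
  qed
  have growth: "\<tau> * exp (c * t) \<le> x t $ i" if "0 \<le> t" for t
  proof -
    let ?u = "\<lambda>t. - (x t $ i * exp (- c * t))"
    have "?u t \<le> ?u 0"
    proof (rule halfline_derivative_nonpos_imp_le[OF _ _ that,
          where u' = "\<lambda>t. - (x t $ i * (excess_demand A (x t) $ i - c) * exp (- c * t))"])
      fix r :: real assume r: "0 \<le> r"
      have "((\<lambda>t. x t $ i) has_real_derivative x r $ i * excess_demand A (x r) $ i) (at r within {0..})"
        using x r bounded_linear.has_vector_derivative[OF bounded_linear_vec_nth, of x "price_field A (x r)" _ i]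
        by (simp add: has_real_derivative_iff_has_vector_derivative price_field_nth forward_solution_def)
      then show "(?u has_real_derivative - (x r $ i * (excess_demand A (x r) $ i - c) * exp (- c * r))) (at r within {0..})"
        by (auto intro!: derivative_eq_intros simp: algebra_simps)
    next
      fix r :: real assume "0 < r"
      then show "- (x r $ i * (excess_demand A (x r) $ i - c) * exp (- c * r)) \<le> 0"
        using xi(1)[of r] \<epsilon>(2)[OF \<delta>2(2)[OF yX yd(2) x, of r]] by simp
    qed
    moreover have "x 0 $ i = \<tau>" using x y' by (simp add: forward_solution_def)
    ultimately show ?thesis by (simp add: exp_minus field_simps)
  qed
  \<comment> \<open>\<open>1 + x \<le> exp x\<close> shows that time \<open>1 / (\<tau> * c)\<close> is already too long\<close>
  have "\<tau> + 1 = \<tau> * (1 + c * (1 / (\<tau> * c)))" using \<tau>(1) c by (simp add: field_simps)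
  also have "\<dots> \<le> \<tau> * exp (c * (1 / (\<tau> * c)))"
    using \<tau>(1) exp_ge_add_one_self by (intro mult_left_mono) auto
  also have "\<dots> \<le> 1" using growth[of "1 / (\<tau> * c)"] xi(2)[of "1 / (\<tau> * c)"] \<tau>(1) c by simp
  finally show False using \<tau>(1) by simp
qed

section \<open>The discriminant\<close>

definition discriminant :: real where
  "discriminant = 4 * (di * dj + dj * dk + dk * di) - (di + dj + dk)\<^sup>2 + (K - L)\<^sup>2"

text \<open>
  Although the discriminant is symmetric in the three edges, on each of them its sign tells which
  of the two parts \<open>\<sigma>\<close> and \<open>dj + dk - di\<close> of the transversal rate is larger in absolute value.
\<close>

lemma discriminant_eq:
  assumes "\<sigma>\<^sup>2 = (K - L)\<^sup>2 + 4 * dj * dk"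
  shows "discriminant = \<sigma>\<^sup>2 - (dj + dk - di)\<^sup>2"
  unfolding discriminant_def assms by (simp add: power2_eq_square algebra_simps)

text \<open>
  For a negative discriminant \<open>\<sigma> < \<bar>dj + dk - di\<bar>\<close>; the second hypothesis selects the edges where this
  makes the rate \<open>\<sigma> - (dj + dk - di)\<close> negative.
\<close>

lemma stable_point_on_edge:
  assumes "discriminant < 0" and "di < dj + dk"
  shows "\<exists>q \<in> open_edge i. locally_asymptotically_stable (price_field A) punctured_triangle q"
proof -
  obtain q where q: "q \<in> open_edge i" "price_field A q = 0" using edge_fixed_point_exists by blast
  obtain \<sigma> where \<sigma>: "0 < \<sigma>" "\<sigma>\<^sup>2 = (K - L)\<^sup>2 + 4 * dj * dk"
    "excess_demand A q $ i = di - dj - dk + \<sigma>"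
    using transversal_rate[OF q] .
  have "\<sigma>\<^sup>2 < (dj + dk - di)\<^sup>2" using assms(1) discriminant_eq[OF \<sigma>(2)] by simp
  then have "\<sigma> < dj + dk - di" by (rule power2_less_imp_less) (use assms(2) in simp)
  then show ?thesis using attracting_edge_fixed_point_stable[OF q] \<sigma>(3) q(1) by (intro bexI[of _ q]) simp_all
qed

lemma no_stable_point_on_edge:
  assumes "0 < discriminant" and q: "q \<in> open_edge i"
  shows "\<not> locally_asymptotically_stable (price_field A) punctured_triangle q"
proof
  assume las: "locally_asymptotically_stable (price_field A) punctured_triangle q"
  then have "price_field A q = 0" by (simp add: locally_asymptotically_stable_def)
  then obtain \<sigma> where \<sigma>: "0 < \<sigma>" "\<sigma>\<^sup>2 = (K - L)\<^sup>2 + 4 * dj * dk"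
    "excess_demand A q $ i = di - dj - dk + \<sigma>"
    using transversal_rate[OF q] by blast
  have "(dj + dk - di)\<^sup>2 < \<sigma>\<^sup>2" using assms(1) discriminant_eq[OF \<sigma>(2)] by simp
  then have "dj + dk - di < \<sigma>" by (rule power2_less_imp_less) (use \<sigma>(1) in simp)
  then show False using repelling_edge_point_not_stable[OF q] \<sigma>(3) las by simp
qed

end

theorem theorem4:
  fixes A :: "real^3^3" and d1 d2 d3 K L H :: real
  assumes "A *v uvec = uvec" and "uvec v* A = uvec"
    and "A = endowment_matrix d1 d2 d3 K L"
    and "d1 + d2 + d3 + K + L = 1"
    and "d1 > 0" and "d2 > 0" and "d3 > 0"
    and "H = 4 * (d1 * d2 + d2 * d3 + d3 * d1) - (d1 + d2 + d3)^2 + (K - L)^2"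
  shows "(H < 0 \<longrightarrow> stable_edge_points A \<noteq> {}) \<and>
         (H > 0 \<longrightarrow> stable_edge_points A = {})"
proof -
  interpret e1: scarf_edge A 1 2 3 d1 d2 d3 K L
    by unfold_locales (use assms(4-7) in \<open>simp_all add: assms(3) endowment_matrix_def\<close>)
  interpret e2: scarf_edge A 2 3 1 d2 d3 d1 K L
    by unfold_locales (use assms(4-7) in \<open>simp_all add: assms(3) endowment_matrix_def\<close>)
  interpret e3: scarf_edge A 3 1 2 d3 d1 d2 K L
    by unfold_locales (use assms(4-7) in \<open>simp_all add: assms(3) endowment_matrix_def\<close>)
  have H: "e1.discriminant = H" "e2.discriminant = H" "e3.discriminant = H"
    unfolding e1.discriminant_def e2.discriminant_def e3.discriminant_def assms(8)
    by (simp_all add: algebra_simps)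
  have "stable_edge_points A \<noteq> {}" if "H < 0"
  proof -
    \<comment> \<open>at most one of the parameters can reach the sum of the other two: adding
      \<open>d1 \<ge> d2 + d3\<close> and \<open>d2 \<ge> d3 + d1\<close> gives \<open>d3 \<le> 0\<close>\<close>
    consider "d1 < d2 + d3" | "d2 < d3 + d1" using \<open>0 < d3\<close> by linarith
    then show ?thesis
      using e1.stable_point_on_edge e2.stable_point_on_edge H that
      by cases (auto simp: stable_edge_points_def)
  qed
  moreover have "stable_edge_points A = {}" if "H > 0"
  proof -
    have "\<not> locally_asymptotically_stable (price_field A) punctured_triangle q"
      if "q \<in> open_edge r" for q r
      using that exhaust_3[of r] e1.no_stable_point_on_edge e2.no_stable_point_on_edge
        e3.no_stable_point_on_edge H \<open>H > 0\<close> by auto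
    then show ?thesis by (auto simp: stable_edge_points_def)
  qed
  ultimately show ?thesis by blast
qed

end
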